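(* Let $(M^n,g)$, $n>3$, be a mixed quasi-Einstein manifold $M(QE)_n$, and let $l,m$ be nowhere vanishing scalar functions on $M$. If $(M,g)$ is semiconformally flat, i.e. $\tilde C(X,Y,Z,W)=0$ for all vector fields $X,Y,Z,W$, where $\tilde C$ is the semiconformal curvature tensor formed with $l,m$, then $(M,g)$ is a manifold of mixed quasi-constant curvature $M(QC)_n$.
   Context: Let $(M^n,g)$ be a semi-Riemannian manifold with Riemann curvature $R(X,Y)Z$, $\tilde R(X,Y,Z,W)=g(R(X,Y)Z,W)$, Ricci tensor $S$ and scalar curvature $r$. The sign convention is the one in which constant curvature $c$ means $R(X,Y)Z=c[g(Y,Z)X-g(X,Z)Y]$, and $S(Y,Z)=\mathrm{trace}(X\mapsto R(X,Y)Z)$. A non-flat $(M^n,g)$, $n\ge3$, is a mixed quasi-Einstein manifold, denoted $M(QE)_n$, if $S(X,Y)=\alpha g(X,Y)+\beta[A(X)B(Y)+A(Y)B(X)]$ with scalar functions $\alpha,\beta$, $\beta\ne0$, and 1-forms $A(X)=g(X,\xi_1)$, $B(X)=g(X,\xi_2)$, where $g(\xi_1,\xi_1)=1$, $g(\xi_2,\xi_2)=1$, $g(\xi_1,\xi_2)=0$. The conformal and conharmonic curvature tensors are $$C(X,Y,Z,W)=\tilde R(X,Y,Z,W)-\tfrac{1}{n-2}[S(Y,Z)g(X,W)-S(X,Z)g(Y,W)+g(Y,Z)S(X,W)-g(X,Z)S(Y,W)]+\tfrac{r}{(n-1)(n-2)}[g(Y,Z)g(X,W)-g(X,Z)g(Y,W)],$$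 $$H(X,Y,Z,W)=\tilde R(X,Y,Z,W)-\tfrac{1}{n-2}[g(X,W)S(Y,Z)-g(X,Z)S(Y,W)+g(Y,Z)S(X,W)-g(Y,W)S(X,Z)].$$ The semiconformal curvature tensor (for nonzero scalar functions $l,m$) is $\tilde C=-(n-2)m\,C+[l+(n-2)m]H$. A non-flat $(M,g)$ is a manifold of mixed quasi-constant curvature, denoted $M(QC)_n$, if there are scalar functions $a,b$ and nonzero 1-forms $A,B$ such that, with $E'(X,Y)=A(X)B(Y)+A(Y)B(X)$, $$\tilde R(X,Y,Z,W)=a[g(Y,Z)g(X,W)-g(X,Z)g(Y,W)]+b[g(X,W)E'(Y,Z)-g(X,Z)E'(Y,W)+g(Y,Z)E'(X,W)-g(Y,W)E'(X,Z)].$$ *)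

theory Defs
  imports "HOL-Analysis.Analysis"
begin

section \<open>Smooth maps between Euclidean spaces\<close>

text \<open>\<open>U\<close> is always an open set below, so \<open>at x\<close> and \<open>at x within U\<close> agree on it.\<close>

primrec Ck_on :: "nat \<Rightarrow> ('b::real_normed_vector \<Rightarrow> 'c::real_normed_vector) \<Rightarrow> 'b set \<Rightarrow> bool" where
  "Ck_on 0 f U \<longleftrightarrow> continuous_on U f"
| "Ck_on (Suc k) f U \<longleftrightarrow>
     f differentiable_on U \<and> (\<forall>v. Ck_on k (\<lambda>x. frechet_derivative f (at x) v) U)"

definition smooth_on :: "('b::real_normed_vector \<Rightarrow> 'c::real_normed_vector) \<Rightarrow> 'b set \<Rightarrow> bool" where
  "smooth_on f U \<longleftrightarrow> (\<forall>k. Ck_on k f U)"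


section \<open>Smooth manifolds, vector fields and 1-forms\<close>

text \<open>A chart is a pair of its domain and its coordinate map; the dimension is \<open>CARD('n)\<close>.\<close>

type_synonym ('a, 'n) chart = "'a set \<times> ('a \<Rightarrow> real^'n)"

definition chart_inv :: "('a, 'n::finite) chart \<Rightarrow> real^'n \<Rightarrow> 'a" where
  "chart_inv c = inv_into (fst c) (snd c)"

definition chart_image :: "('a, 'n::finite) chart \<Rightarrow> (real^'n) set" where
  "chart_image c = snd c ` fst c"

definition is_chart :: "'a topology \<Rightarrow> ('a, 'n::finite) chart \<Rightarrow> bool" where
  "is_chart T c \<longleftrightarrow>
     openin T (fst c) \<and> open (chart_image c) \<and>
     homeomorphic_map (subtopology T (fst c)) (top_of_set (chart_image c)) (snd c)"

definition smooth_manifold :: "'a topology \<Rightarrow> ('a, 'n::finite) chart set \<Rightarrow> bool" where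
  "smooth_manifold T \<A> \<longleftrightarrow>
     Hausdorff_space T \<and> second_countable T \<and>
     (\<forall>c\<in>\<A>. is_chart T c) \<and> (\<Union>c\<in>\<A>. fst c) = topspace T \<and>
     (\<forall>c\<in>\<A>. \<forall>d\<in>\<A>. smooth_on (snd d \<circ> chart_inv c) (snd c ` (fst c \<inter> fst d)))"

text \<open>
  The tangent space at \<open>p\<close> is represented by \<open>real^'n\<close> through a preferred chart around \<open>p\<close>:
  the vector \<open>v\<close> stands for the tangent vector with components \<open>v\<close> in \<open>chart_at \<A> p\<close>.
  Components in any other chart are obtained from the Jacobian of the change of coordinates.
\<close>

definition chart_at :: "('a, 'n::finite) chart set \<Rightarrow> 'a \<Rightarrow> ('a, 'n) chart" where
  "chart_at \<A> p = (SOME c. c \<in> \<A> \<and> p \<in> fst c)"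

definition coord_change ::
    "('a, 'n::finite) chart \<Rightarrow> ('a, 'n) chart \<Rightarrow> 'a \<Rightarrow> real^'n \<Rightarrow> real^'n" where
  "coord_change c d p = frechet_derivative (snd d \<circ> chart_inv c) (at (snd c p))"

definition smooth_function :: "('a, 'n::finite) chart set \<Rightarrow> ('a \<Rightarrow> real) \<Rightarrow> bool" where
  "smooth_function \<A> f \<longleftrightarrow> (\<forall>c\<in>\<A>. smooth_on (f \<circ> chart_inv c) (chart_image c))"

definition local_field ::
    "('a, 'n::finite) chart set \<Rightarrow> ('a \<Rightarrow> real^'n) \<Rightarrow> ('a, 'n) chart \<Rightarrow> real^'n \<Rightarrow> real^'n" where
  "local_field \<A> X c x = (let p = chart_inv c x in coord_change (chart_at \<A> p) c p (X p))"

definition vector_field :: "('a, 'n::finite) chart set \<Rightarrow> ('a \<Rightarrow> real^'n) \<Rightarrow> bool" where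
  "vector_field \<A> X \<longleftrightarrow> (\<forall>c\<in>\<A>. smooth_on (local_field \<A> X c) (chart_image c))"

definition local_form ::
    "('a, 'n::finite) chart set \<Rightarrow> ('a \<Rightarrow> real^'n \<Rightarrow> real) \<Rightarrow> ('a, 'n) chart
      \<Rightarrow> real^'n \<Rightarrow> real^'n \<Rightarrow> real" where
  "local_form \<A> \<omega> c x u = (let p = chart_inv c x in \<omega> p (coord_change c (chart_at \<A> p) p u))"

definition one_form ::
    "'a topology \<Rightarrow> ('a, 'n::finite) chart set \<Rightarrow> ('a \<Rightarrow> real^'n \<Rightarrow> real) \<Rightarrow> bool" where
  "one_form T \<A> \<omega> \<longleftrightarrow>
     (\<forall>p\<in>topspace T. linear (\<omega> p)) \<and>
     (\<forall>c\<in>\<A>. \<forall>u. smooth_on (\<lambda>x. local_form \<A> \<omega> c x u) (chart_image c))"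


section \<open>Semi-Riemannian metrics\<close>

type_synonym ('a, 'n) metric = "'a \<Rightarrow> real^'n \<Rightarrow> real^'n \<Rightarrow> real"

definition local_metric ::
    "('a, 'n::finite) chart set \<Rightarrow> ('a, 'n) metric \<Rightarrow> ('a, 'n) chart
      \<Rightarrow> real^'n \<Rightarrow> real^'n \<Rightarrow> real^'n \<Rightarrow> real" where
  "local_metric \<A> g c x u v =
     (let p = chart_inv c x; J = coord_change c (chart_at \<A> p) p in g p (J u) (J v))"

definition form_index :: "(real^'n::finite \<Rightarrow> real^'n \<Rightarrow> real) \<Rightarrow> nat" where
  "form_index b = Max {dim V |V. subspace V \<and> (\<forall>v\<in>V. v \<noteq> 0 \<longrightarrow> b v v < 0)}"

definition semi_riemannian_metric ::
    "'a topology \<Rightarrow> ('a, 'n::finite) chart set \<Rightarrow> ('a, 'n) metric \<Rightarrow> bool" where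
  "semi_riemannian_metric T \<A> g \<longleftrightarrow>
     (\<forall>p\<in>topspace T. bilinear (g p) \<and> (\<forall>x y. g p x y = g p y x) \<and>
        (\<forall>x. (\<forall>y. g p x y = 0) \<longrightarrow> x = 0)) \<and>
     (\<forall>c\<in>\<A>. \<forall>u v. smooth_on (\<lambda>x. local_metric \<A> g c x u v) (chart_image c)) \<and>
     (\<exists>\<nu>. \<forall>p\<in>topspace T. form_index (g p) = \<nu>)"

definition semi_riemannian_manifold ::
    "'a topology \<Rightarrow> ('a, 'n::finite) chart set \<Rightarrow> ('a, 'n) metric \<Rightarrow> bool" where
  "semi_riemannian_manifold T \<A> g \<longleftrightarrow> smooth_manifold T \<A> \<and> semi_riemannian_metric T \<A> g"


section \<open>Levi-Civita connection and curvature\<close>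

text \<open>
  First in one coordinate domain, where \<open>G\<close> is the metric in coordinates and vector fields are
  maps from points to component vectors. \<open>christoffel G x u v\<close> is the vector
  \<open>\<nabla>\<^sub>u v\<close> at \<open>x\<close> for constant-coefficient fields \<open>u\<close>, \<open>v\<close>; its defining equation is the Koszul
  formula, in which the brackets of constant-coefficient fields vanish.
\<close>

definition christoffel ::
    "(real^'n::finite \<Rightarrow> real^'n \<Rightarrow> real^'n \<Rightarrow> real) \<Rightarrow> real^'n \<Rightarrow> real^'n \<Rightarrow> real^'n \<Rightarrow> real^'n" where
  "christoffel G x u v = (THE w. \<forall>z. 2 * G x w z =
       frechet_derivative (\<lambda>y. G y v z) (at x) u
     + frechet_derivative (\<lambda>y. G y u z) (at x) v
     - frechet_derivative (\<lambda>y. G y u v) (at x) z)"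

definition local_nabla ::
    "(real^'n::finite \<Rightarrow> real^'n \<Rightarrow> real^'n \<Rightarrow> real)
      \<Rightarrow> (real^'n \<Rightarrow> real^'n) \<Rightarrow> (real^'n \<Rightarrow> real^'n) \<Rightarrow> real^'n \<Rightarrow> real^'n" where
  "local_nabla G X Y x = frechet_derivative Y (at x) (X x) + christoffel G x (X x) (Y x)"

definition local_bracket ::
    "(real^'n::finite \<Rightarrow> real^'n) \<Rightarrow> (real^'n \<Rightarrow> real^'n) \<Rightarrow> real^'n \<Rightarrow> real^'n" where
  "local_bracket X Y x = frechet_derivative Y (at x) (X x) - frechet_derivative X (at x) (Y x)"

definition local_curvature ::
    "(real^'n::finite \<Rightarrow> real^'n \<Rightarrow> real^'n \<Rightarrow> real)
      \<Rightarrow> (real^'n \<Rightarrow> real^'n) \<Rightarrow> (real^'n \<Rightarrow> real^'n) \<Rightarrow> (real^'n \<Rightarrow> real^'n) \<Rightarrow> real^'n \<Rightarrow> real^'n" where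
  "local_curvature G X Y Z x =
     local_nabla G X (local_nabla G Y Z) x - local_nabla G Y (local_nabla G X Z) x
     - local_nabla G (local_bracket X Y) Z x"

text \<open>
  The curvature is tensorial, so its value on tangent vectors at \<open>p\<close> may be computed from any
  extensions to vector fields near \<open>p\<close>; we take those with constant coefficients in the
  preferred chart.
\<close>

definition riemann ::
    "('a, 'n::finite) chart set \<Rightarrow> ('a, 'n) metric \<Rightarrow> 'a \<Rightarrow> real^'n \<Rightarrow> real^'n \<Rightarrow> real^'n \<Rightarrow> real^'n" where
  "riemann \<A> g p x y z =
     (let c = chart_at \<A> p
      in local_curvature (local_metric \<A> g c) (\<lambda>_. x) (\<lambda>_. y) (\<lambda>_. z) (snd c p))"

definition riemann4 ::
    "('a, 'n::finite) chart set \<Rightarrow> ('a, 'n) metric \<Rightarrow> 'a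
      \<Rightarrow> real^'n \<Rightarrow> real^'n \<Rightarrow> real^'n \<Rightarrow> real^'n \<Rightarrow> real" where
  "riemann4 \<A> g p x y z w = g p (riemann \<A> g p x y z) w"

definition ricci ::
    "('a, 'n::finite) chart set \<Rightarrow> ('a, 'n) metric \<Rightarrow> 'a \<Rightarrow> real^'n \<Rightarrow> real^'n \<Rightarrow> real" where
  "ricci \<A> g p y z = trace (matrix (\<lambda>x. riemann \<A> g p x y z))"

definition ricci_operator ::
    "('a, 'n::finite) chart set \<Rightarrow> ('a, 'n) metric \<Rightarrow> 'a \<Rightarrow> real^'n \<Rightarrow> real^'n" where
  "ricci_operator \<A> g p x = (THE q. \<forall>y. g p q y = ricci \<A> g p x y)"

definition scalar_curvature ::
    "('a, 'n::finite) chart set \<Rightarrow> ('a, 'n) metric \<Rightarrow> 'a \<Rightarrow> real" where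
  "scalar_curvature \<A> g p = trace (matrix (ricci_operator \<A> g p))"

definition flat_manifold ::
    "'a topology \<Rightarrow> ('a, 'n::finite) chart set \<Rightarrow> ('a, 'n) metric \<Rightarrow> bool" where
  "flat_manifold T \<A> g \<longleftrightarrow> (\<forall>p\<in>topspace T. \<forall>x y z. riemann \<A> g p x y z = 0)"


section \<open>Conformal, conharmonic and semiconformal curvature tensors\<close>

definition conformal_tensor ::
    "('a, 'n::finite) chart set \<Rightarrow> ('a, 'n) metric \<Rightarrow> 'a
      \<Rightarrow> real^'n \<Rightarrow> real^'n \<Rightarrow> real^'n \<Rightarrow> real^'n \<Rightarrow> real" where
  "conformal_tensor \<A> g p x y z w =
     (let n = real CARD('n); S = ricci \<A> g p; r = scalar_curvature \<A> g p
      in riemann4 \<A> g p x y z w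
         - 1 / (n - 2) * (S y z * g p x w - S x z * g p y w + g p y z * S x w - g p x z * S y w)
         + r / ((n - 1) * (n - 2)) * (g p y z * g p x w - g p x z * g p y w))"

definition conharmonic_tensor ::
    "('a, 'n::finite) chart set \<Rightarrow> ('a, 'n) metric \<Rightarrow> 'a
      \<Rightarrow> real^'n \<Rightarrow> real^'n \<Rightarrow> real^'n \<Rightarrow> real^'n \<Rightarrow> real" where
  "conharmonic_tensor \<A> g p x y z w =
     (let n = real CARD('n); S = ricci \<A> g p
      in riemann4 \<A> g p x y z w
         - 1 / (n - 2) * (g p x w * S y z - g p x z * S y w + g p y z * S x w - g p y w * S x z))"

definition semiconformal_tensor ::
    "('a, 'n::finite) chart set \<Rightarrow> ('a, 'n) metric \<Rightarrow> ('a \<Rightarrow> real) \<Rightarrow> ('a \<Rightarrow> real) \<Rightarrow> 'a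
      \<Rightarrow> real^'n \<Rightarrow> real^'n \<Rightarrow> real^'n \<Rightarrow> real^'n \<Rightarrow> real" where
  "semiconformal_tensor \<A> g l m p x y z w =
     (let n = real CARD('n)
      in - (n - 2) * m p * conformal_tensor \<A> g p x y z w
         + (l p + (n - 2) * m p) * conharmonic_tensor \<A> g p x y z w)"

definition semiconformally_flat ::
    "'a topology \<Rightarrow> ('a, 'n::finite) chart set \<Rightarrow> ('a, 'n) metric \<Rightarrow> ('a \<Rightarrow> real) \<Rightarrow> ('a \<Rightarrow> real)
      \<Rightarrow> bool" where
  "semiconformally_flat T \<A> g l m \<longleftrightarrow>
     (\<forall>X Y Z W. vector_field \<A> X \<longrightarrow> vector_field \<A> Y \<longrightarrow> vector_field \<A> Z \<longrightarrow> vector_field \<A> W \<longrightarrow>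
        (\<forall>p\<in>topspace T. semiconformal_tensor \<A> g l m p (X p) (Y p) (Z p) (W p) = 0))"


section \<open>Mixed quasi-Einstein manifolds and mixed quasi-constant curvature\<close>

definition mixed_product ::
    "('a \<Rightarrow> real^'n \<Rightarrow> real) \<Rightarrow> ('a \<Rightarrow> real^'n \<Rightarrow> real) \<Rightarrow> 'a \<Rightarrow> real^'n::finite \<Rightarrow> real^'n \<Rightarrow> real" where
  "mixed_product A B p x y = A p x * B p y + A p y * B p x"

text \<open>\<open>\<beta> \<noteq> 0\<close> is read as: \<open>\<beta>\<close> is not the zero function, the weaker of the possible hypotheses.\<close>

definition mixed_quasi_einstein ::
    "'a topology \<Rightarrow> ('a, 'n::finite) chart set \<Rightarrow> ('a, 'n) metric \<Rightarrow> bool" where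
  "mixed_quasi_einstein T \<A> g \<longleftrightarrow>
     semi_riemannian_manifold T \<A> g \<and> CARD('n) \<ge> 3 \<and> \<not> flat_manifold T \<A> g \<and>
     (\<exists>\<alpha> \<beta> \<xi>\<^sub>1 \<xi>\<^sub>2 A B.
        smooth_function \<A> \<alpha> \<and> smooth_function \<A> \<beta> \<and> (\<exists>p\<in>topspace T. \<beta> p \<noteq> 0) \<and>
        vector_field \<A> \<xi>\<^sub>1 \<and> vector_field \<A> \<xi>\<^sub>2 \<and>
        A = (\<lambda>p x. g p x (\<xi>\<^sub>1 p)) \<and> B = (\<lambda>p x. g p x (\<xi>\<^sub>2 p)) \<and>
        (\<forall>p\<in>topspace T. g p (\<xi>\<^sub>1 p) (\<xi>\<^sub>1 p) = 1 \<and> g p (\<xi>\<^sub>2 p) (\<xi>\<^sub>2 p) = 1 \<and> g p (\<xi>\<^sub>1 p) (\<xi>\<^sub>2 p) = 0) \<and>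
        (\<forall>X Y. vector_field \<A> X \<longrightarrow> vector_field \<A> Y \<longrightarrow>
           (\<forall>p\<in>topspace T. ricci \<A> g p (X p) (Y p) =
              \<alpha> p * g p (X p) (Y p) + \<beta> p * mixed_product A B p (X p) (Y p))))"

text \<open>``Nonzero 1-forms'' is read as: vanishing at no point, the stronger of the possible
  conclusions.\<close>

definition mixed_quasi_constant_curvature ::
    "'a topology \<Rightarrow> ('a, 'n::finite) chart set \<Rightarrow> ('a, 'n) metric \<Rightarrow> bool" where
  "mixed_quasi_constant_curvature T \<A> g \<longleftrightarrow>
     semi_riemannian_manifold T \<A> g \<and> \<not> flat_manifold T \<A> g \<and>
     (\<exists>a b A B.
        smooth_function \<A> a \<and> smooth_function \<A> b \<and> one_form T \<A> A \<and> one_form T \<A> B \<and>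
        (\<forall>p\<in>topspace T. (\<exists>x. A p x \<noteq> 0) \<and> (\<exists>x. B p x \<noteq> 0)) \<and>
        (\<forall>X Y Z W. vector_field \<A> X \<longrightarrow> vector_field \<A> Y \<longrightarrow> vector_field \<A> Z \<longrightarrow> vector_field \<A> W \<longrightarrow>
           (\<forall>p\<in>topspace T. let x = X p; y = Y p; z = Z p; w = W p; E = mixed_product A B p in
              riemann4 \<A> g p x y z w =
                a p * (g p y z * g p x w - g p x z * g p y w)
              + b p * (g p x w * E y z - g p x z * E y w + g p y z * E x w - g p y w * E x z))))"

end

theory Submission
  imports Defs
begin

text \<open>
  Since the conformal and conharmonic tensors differ by a multiple of
  \<open>Q(x,y,z,w) = g(y,z) g(x,w) - g(x,z) g(y,w)\<close>, semiconformal flatness says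
  \<open>l H = m r / (n - 1) Q\<close>. Inserting the quasi-Einstein form of the Ricci tensor gives the
  mixed quasi-constant form of the curvature at each point, with \<open>b = \<beta> / (n - 2)\<close> and an
  a priori unknown coefficient \<open>K\<close> of \<open>Q\<close>. Then
  \<open>R(x,\<xi>\<^sub>1)\<xi>\<^sub>1 = K (x - A(x) \<xi>\<^sub>1)\<close>, and taking the trace yields \<open>K = \<alpha> / (n - 1)\<close>, which is smooth.
  The trace runs over all tangent vectors, whereas the hypotheses speak only of global vector
  fields, so tangent vectors have to be extended by means of a bump function.
\<close>

section \<open>Calculus of smooth maps\<close>

text \<open>\<open>frechet_derivative\<close> is a choice from the \<open>has_derivative\<close>
  predicate, and functions that agree near \<open>x\<close> have the same predicate, differentiable
  or not.\<close>

lemma frechet_derivative_transform_open: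
  assumes "open U" "x \<in> U" "\<And>y. y \<in> U \<Longrightarrow> f y = g y"
  shows "frechet_derivative f (at x) = frechet_derivative g (at x)"
proof -
  have "(f has_derivative D) (at x) \<longleftrightarrow> (g has_derivative D) (at x)" for D
    using has_derivative_transform_within_open[OF _ assms(1,2)] assms(3) by metis
  then show ?thesis
    by (simp add: frechet_derivative_def)
qed

lemma Ck_on_SucI:
  assumes "open U" "\<And>x. x \<in> U \<Longrightarrow> (f has_derivative D x) (at x)"
    and "\<And>v. Ck_on k (\<lambda>x. frechet_derivative f (at x) v) U"
  shows "Ck_on (Suc k) f U"
  using assms by (auto simp: differentiable_on_eq_differentiable_at differentiable_def)

lemma Ck_on_Suc_has_derivative:
  assumes "Ck_on (Suc k) f U" "open U" "x \<in> U"
  shows "(f has_derivative frechet_derivative f (at x)) (at x)"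
  using assms by (auto simp: differentiable_on_eq_differentiable_at frechet_derivative_works[symmetric])

lemma Ck_on_Suc_imp: "Ck_on (Suc k) f U \<Longrightarrow> Ck_on k f U"
proof (induction k arbitrary: f)
  case 0
  then show ?case by (auto intro: differentiable_imp_continuous_on)
next
  case (Suc k)
  then show ?case by (simp only: Ck_on.simps) blast
qed

text \<open>Coordinate expressions are total functions whose identities hold only on chart images;
  since \<open>U\<close> is open, values elsewhere do not affect derivatives on it.\<close>

lemma Ck_on_cong:
  assumes "open U" "\<And>x. x \<in> U \<Longrightarrow> f x = g x" "Ck_on k f U"
  shows "Ck_on k g U"
  using assms
proof (induction k arbitrary: f g)
  case 0
  then show ?case by (auto cong: continuous_on_cong)
next
  case (Suc k)
  show ?case
  proof (rule Ck_on_SucI[OF Suc.prems(1)])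
    fix x assume x: "x \<in> U"
    show "(g has_derivative frechet_derivative f (at x)) (at x)"
      using has_derivative_transform_within_open[OF
          Ck_on_Suc_has_derivative[OF Suc.prems(3,1) x] Suc.prems(1) x] Suc.prems(2) by blast
  next
    fix v
    show "Ck_on k (\<lambda>x. frechet_derivative g (at x) v) U"
      by (rule Suc.IH[where f = "\<lambda>x. frechet_derivative f (at x) v"])
        (use Suc.prems frechet_derivative_transform_open[OF Suc.prems(1), of _ f g] in auto)
  qed
qed

lemma Ck_on_Suc_from_derivative:
  assumes "open U" "\<And>x. x \<in> U \<Longrightarrow> (f has_derivative D x) (at x)"
    and "\<And>v. Ck_on k (\<lambda>x. D x v) U"
  shows "Ck_on (Suc k) f U"
proof (rule Ck_on_SucI[OF assms(1,2)])
  fix v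
  show "Ck_on k (\<lambda>x. frechet_derivative f (at x) v) U"
    by (rule Ck_on_cong[OF assms(1) _ assms(3)[of v]])
      (simp add: frechet_derivative_at[OF assms(2), symmetric])
qed

section \<open>Closure and gluing properties of the classes \<open>Ck_on k\<close>\<close>

lemma Ck_on_const: "open U \<Longrightarrow> Ck_on k (\<lambda>x. c) U"
  by (induction k arbitrary: c) (auto intro!: Ck_on_Suc_from_derivative has_derivative_const simp del: Ck_on.simps(2))

text \<open>The induction works because \<open>frechet_derivative f (at x)\<close> does not refer to
  \<open>U\<close>. Serves to join two open pieces covering a chart image.\<close>

lemma Ck_on_locally:
  assumes "\<And>x. x \<in> U \<Longrightarrow> \<exists>V. open V \<and> x \<in> V \<and> Ck_on k f V"
  shows "Ck_on k f U"
  using assms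
proof (induction k arbitrary: f)
  case 0
  show ?case
  proof (clarsimp simp: continuous_on_eq_continuous_within)
    fix x assume "x \<in> U"
    then obtain V where "open V" "x \<in> V" "continuous_on V f" using 0 by force
    then show "continuous (at x within U) f"
      by (simp add: continuous_on_eq_continuous_at continuous_at_imp_continuous_at_within)
  qed
next
  case (Suc k)
  have "f differentiable at x within U" if "x \<in> U" for x
  proof -
    obtain V where "open V" "x \<in> V" "f differentiable_on V" using Suc.prems[OF \<open>x \<in> U\<close>] by auto
    then show ?thesis
      by (meson differentiable_at_withinI differentiable_on_eq_differentiable_at)
  qed
  moreover have "Ck_on k (\<lambda>x. frechet_derivative f (at x) v) U" for v
    using Suc.prems by (intro Suc.IH) fastforce
  ultimately show ?case by (simp add: differentiable_on_def)
qed

lemma Ck_on_add: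
  assumes "open U" "Ck_on k f U" "Ck_on k g U"
  shows "Ck_on k (\<lambda>x. f x + g x) U"
  using assms
proof (induction k arbitrary: f g)
  case 0
  then show ?case by (auto intro: continuous_intros)
next
  case (Suc k)
  show ?case
    by (rule Ck_on_Suc_from_derivative[OF Suc.prems(1)])
      (auto intro!: has_derivative_add Ck_on_Suc_has_derivative[OF Suc.prems(2,1)]
        Ck_on_Suc_has_derivative[OF Suc.prems(3,1)] Suc.IH Suc.prems(1)
        simp: Suc.prems(2,3)[unfolded Ck_on.simps])
qed

text \<open>The product rule again gives terms of the form \<open>b (f x) (g x)\<close>, with one
  factor differentiated and the other lowered by one order; hence the generalisation over both
  \<open>f\<close> and \<open>g\<close>.\<close>

lemma Ck_on_bilinear:
  assumes "bounded_bilinear b" "open U" "Ck_on k f U" "Ck_on k g U"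
  shows "Ck_on k (\<lambda>x. b (f x) (g x)) U"
  using assms
proof (induction k arbitrary: f g)
  case 0
  then show ?case by (auto intro: bounded_bilinear.continuous_on)
next
  case (Suc k)
  show ?case
  proof (rule Ck_on_Suc_from_derivative[OF Suc.prems(2)])
    fix x assume x: "x \<in> U"
    show "((\<lambda>x. b (f x) (g x)) has_derivative
        (\<lambda>v. b (f x) (frechet_derivative g (at x) v) + b (frechet_derivative f (at x) v) (g x))) (at x)"
      by (intro bounded_bilinear.FDERIV[OF Suc.prems(1)]
          Ck_on_Suc_has_derivative[OF Suc.prems(3,2) x] Ck_on_Suc_has_derivative[OF Suc.prems(4,2) x])
  next
    fix v
    show "Ck_on k (\<lambda>x. b (f x) (frechet_derivative g (at x) v)
        + b (frechet_derivative f (at x) v) (g x)) U"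
      by (intro Ck_on_add Suc.IH Suc.prems(1,2) Ck_on_Suc_imp[OF Suc.prems(3)]
          Ck_on_Suc_imp[OF Suc.prems(4)])
        (use Suc.prems(3,4) in auto)
  qed
qed

lemma Ck_on_bounded_linear:
  assumes "bounded_linear L" "open U" "Ck_on k f U"
  shows "Ck_on k (\<lambda>x. L (f x)) U"
proof -
  have "bounded_bilinear (\<lambda>r y. r *\<^sub>R L y)"
    using bounded_bilinear.comp[OF bounded_bilinear_scaleR bounded_linear_ident assms(1)] .
  from Ck_on_bilinear[OF this assms(2) Ck_on_const[OF assms(2), of k 1] assms(3)]
  show ?thesis by simp
qed

lemma Ck_on_sum:
  assumes "open U" "\<And>i. i \<in> I \<Longrightarrow> Ck_on k (f i) U"
  shows "Ck_on k (\<lambda>x. \<Sum>i\<in>I. f i x) U"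
  using assms(2)
  by (induction I rule: infinite_finite_induct) (auto intro: Ck_on_const Ck_on_add assms(1))

text \<open>\<open>Ck_on\<close> controls a derivative only in fixed directions; expanding
  \<open>Y x\<close> in the basis handles a direction that varies with \<open>x\<close>.\<close>

lemma Ck_on_linear_in_field:
  fixes Y :: "'b::real_normed_vector \<Rightarrow> 'c::euclidean_space"
  assumes "open U" "\<And>e. Ck_on k (\<lambda>x. L x e) U" "Ck_on k Y U" "\<And>x. x \<in> U \<Longrightarrow> linear (L x)"
  shows "Ck_on k (\<lambda>x. L x (Y x)) U"
proof (rule Ck_on_cong[OF assms(1)])
  show "Ck_on k (\<lambda>x. \<Sum>e\<in>Basis. (Y x \<bullet> e) *\<^sub>R L x e) U"
    by (intro Ck_on_sum Ck_on_bilinear[OF bounded_bilinear_scaleR] assms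
        Ck_on_bounded_linear[OF bounded_linear_inner_left])
  fix x assume "x \<in> U"
  have "L x (Y x) = L x (\<Sum>e\<in>Basis. (Y x \<bullet> e) *\<^sub>R e)"
    by (simp add: euclidean_representation)
  then show "(\<Sum>e\<in>Basis. (Y x \<bullet> e) *\<^sub>R L x e) = L x (Y x)"
    using assms(4)[OF \<open>x \<in> U\<close>] by (simp add: linear_sum linear_scale)
qed

text \<open>By the chain rule the derivative is that of \<open>f\<close> at \<open>h x\<close>,
  applied to a varying vector. Only \<open>f\<close> is generalised, since the hypothesis is applied
  to its directional derivatives with the same \<open>h\<close>.\<close>

lemma Ck_on_compose:
  fixes h :: "'b::real_normed_vector \<Rightarrow> 'c::euclidean_space"
  assumes "open U" "open V" "h ` U \<subseteq> V" "Ck_on k h U" "Ck_on k f V"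
  shows "Ck_on k (\<lambda>x. f (h x)) U"
  using assms
proof (induction k arbitrary: f)
  case 0
  then show ?case by (auto intro: continuous_on_compose2)
next
  case (Suc k)
  have der: "(f has_derivative frechet_derivative f (at (h x))) (at (h x))" if "x \<in> U" for x
    using that Suc.prems by (intro Ck_on_Suc_has_derivative) auto
  show ?case
  proof (rule Ck_on_Suc_from_derivative[OF Suc.prems(1)])
    fix x assume x: "x \<in> U"
    show "((\<lambda>x. f (h x)) has_derivative
        (\<lambda>v. frechet_derivative f (at (h x)) (frechet_derivative h (at x) v))) (at x)"
      using has_derivative_compose[OF Ck_on_Suc_has_derivative[OF Suc.prems(4,1) x] der[OF x]] .
  next
    fix v
    show "Ck_on k (\<lambda>x. frechet_derivative f (at (h x)) (frechet_derivative h (at x) v)) U"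
    proof (rule Ck_on_linear_in_field[OF Suc.prems(1)])
      show "Ck_on k (\<lambda>x. frechet_derivative f (at (h x)) e) U" for e
        by (rule Suc.IH[OF Suc.prems(1-3) Ck_on_Suc_imp[OF Suc.prems(4)]]) (use Suc.prems(5) in auto)
      show "Ck_on k (\<lambda>x. frechet_derivative h (at x) v) U" using Suc.prems(4) by auto
    qed (use der has_derivative_linear in blast)
  qed
qed

lemma Ck_on_id: "open U \<Longrightarrow> Ck_on k (\<lambda>x. x) U"
  by (cases k) (auto intro!: Ck_on_Suc_from_derivative[where D = "\<lambda>x v. v"] has_derivative_ident
      Ck_on_const simp del: Ck_on.simps(2))


section \<open>A bump function\<close>

text \<open>The function t^(-j) e^(-1/t), extended by 0 to t \<le> 0. The index j makes the family
  closed under differentiation up to linear combinations.\<close>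

definition flat_exp :: "nat \<Rightarrow> real \<Rightarrow> real" where
  "flat_exp j t = (if t \<le> 0 then 0 else (1 / t) ^ j * exp (- (1 / t)))"

lemma flat_exp_tendsto_0: "(flat_exp j \<longlongrightarrow> 0) (at 0)"
proof -
  have "((\<lambda>t. flat_exp j t) \<longlongrightarrow> 0) (at_right 0)"
  proof (rule Lim_transform_eventually)
    \<comment> \<open>The substitution s = 1/t moves the right-hand limit at 0 to infinity.\<close>
    have "((\<lambda>t. t ^ j / exp t) \<longlongrightarrow> 0) (at_top :: real filter)"
      by (rule tendsto_power_div_exp_0)
    then show "((\<lambda>t::real. inverse t ^ j / exp (inverse t)) \<longlongrightarrow> 0) (at_right 0)"
      by (rule filterlim_compose[OF _ filterlim_inverse_at_top_right])
    show "\<forall>\<^sub>F t in at_right 0. inverse t ^ j / exp (inverse t) = flat_exp j t"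
      by (auto simp: eventually_at_filter flat_exp_def exp_minus field_simps)
  qed
  moreover have "((\<lambda>t. flat_exp j t) \<longlongrightarrow> 0) (at_left 0)"
    by (rule Lim_transform_eventually[OF tendsto_const])
      (auto simp: eventually_at_filter flat_exp_def)
  ultimately show ?thesis by (simp add: filterlim_split_at)
qed

lemma flat_exp_has_field_derivative:
  "(flat_exp j has_field_derivative (flat_exp (j + 2) t - real j * flat_exp (j + 1) t)) (at t)"
proof -
  consider "t < 0" | "t = 0" | "t > 0" by linarith
  then show ?thesis
  proof cases
    case 1
    have "((\<lambda>t. 0) has_field_derivative 0) (at t)" by simp
    then have "(flat_exp j has_field_derivative 0) (at t)"
      by (rule has_field_derivative_transform_within_open[where S = "{..<0}"])
        (use 1 in \<open>auto simp: flat_exp_def\<close>)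
    then show ?thesis using 1 by (simp add: flat_exp_def)
  next
    case 2
    \<comment> \<open>The difference quotient at 0 is \<open>flat_exp (Suc j)\<close>, which tends
      to 0.\<close>
    have "((\<lambda>h. flat_exp j h / h) \<longlongrightarrow> 0) (at 0)"
      by (rule Lim_transform_eventually[OF flat_exp_tendsto_0[of "Suc j"]])
        (auto simp: eventually_at_filter flat_exp_def field_simps)
    then show ?thesis using 2 by (simp add: DERIV_def flat_exp_def)
  next
    case 3
    have inv: "((\<lambda>t. 1 / t) has_field_derivative - ((1 / t)\<^sup>2)) (at t)"
      using 3 by (auto intro!: derivative_eq_intros simp: power2_eq_square)
    have pow: "((\<lambda>t. (1 / t) ^ j) has_field_derivative - real j * (1 / t) ^ (j + 1)) (at t)"
      by (rule DERIV_cong[OF DERIV_power[OF inv]], cases j) (use 3 in \<open>simp_all add: power2_eq_square divide_simps\<close>)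
    have "((\<lambda>t. exp (- (1 / t))) has_field_derivative exp (- (1 / t)) * (1 / t)\<^sup>2) (at t)"
      using DERIV_chain2[OF DERIV_exp DERIV_minus[OF inv]] by simp
    from DERIV_mult[OF pow this]
    have "((\<lambda>t. (1 / t) ^ j * exp (- (1 / t))) has_field_derivative
        (flat_exp (j + 2) t - real j * flat_exp (j + 1) t)) (at t)"
      using 3 by (simp add: flat_exp_def power2_eq_square algebra_simps)
    then show ?thesis
      by (rule has_field_derivative_transform_within_open[where S = "{0<..}"])
        (use 3 in \<open>auto simp: flat_exp_def\<close>)
  qed
qed

lemma Ck_on_flat_exp: "Ck_on k (flat_exp j) UNIV"
proof (induction k arbitrary: j)
  case 0
  show ?case
    using flat_exp_has_field_derivative[of j]
    by (auto intro!: continuous_at_imp_continuous_on DERIV_isCont)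
next
  case (Suc k)
  show ?case
  proof (rule Ck_on_Suc_from_derivative)
    fix x
    show "(flat_exp j has_derivative
        (\<lambda>v. (flat_exp (j + 2) x + (- real j) * flat_exp (j + 1) x) * v)) (at x)"
      using flat_exp_has_field_derivative[of j x] by (simp add: has_field_derivative_def)
  next
    fix v
    show "Ck_on k (\<lambda>x. (flat_exp (j + 2) x + (- real j) * flat_exp (j + 1) x) * v) UNIV"
      by (intro Ck_on_bilinear[OF bounded_bilinear_mult] Ck_on_add Ck_on_const Suc.IH) auto
  qed auto
qed

text \<open>The argument is r^2 - |x - x0|^2, written with sums and scalar factors only so that the
  closure rules apply literally.\<close>

lemma Ck_on_bump:
  fixes x0 :: "'b::euclidean_space"
  shows "Ck_on k (\<lambda>x. flat_exp 0 (r\<^sup>2 + (-1) * ((x + - x0) \<bullet> (x + - x0)))) UNIV"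
  by (rule Ck_on_compose[where V = UNIV and f = "flat_exp 0", OF open_UNIV open_UNIV subset_UNIV _ Ck_on_flat_exp])
    (intro Ck_on_add Ck_on_const Ck_on_id open_UNIV
      Ck_on_bilinear[OF bounded_bilinear_mult] Ck_on_bilinear[OF bounded_bilinear_inner])

lemma bump_eq_0_iff:
  fixes x0 :: "'b::euclidean_space"
  assumes "r > 0"
  shows "flat_exp 0 (r\<^sup>2 + (-1) * ((x + - x0) \<bullet> (x + - x0))) = 0 \<longleftrightarrow> dist x0 x \<ge> r"
proof -
  have "(x + - x0) \<bullet> (x + - x0) = (dist x0 x)\<^sup>2"
    by (simp add: dist_norm norm_minus_commute power2_norm_eq_inner)
  moreover have "r\<^sup>2 \<le> (dist x0 x)\<^sup>2 \<longleftrightarrow> r \<le> dist x0 x"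
    using assms by (auto intro: power_mono power2_le_imp_le)
  ultimately show ?thesis by (auto simp: flat_exp_def)
qed


section \<open>Charts and extension of tangent vectors\<close>

context
  fixes T :: "'a topology" and \<A> :: "('a, 'n::finite) chart set"
  assumes manifold: "smooth_manifold T \<A>"
begin

section \<open>Charts as homeomorphisms onto open sets\<close>

lemma chart_domain_openin: "c \<in> \<A> \<Longrightarrow> openin T (fst c)"
  and chart_image_open: "c \<in> \<A> \<Longrightarrow> open (chart_image c)"
  and chart_homeomorphic_map: "c \<in> \<A> \<Longrightarrow>
    homeomorphic_map (subtopology T (fst c)) (top_of_set (chart_image c)) (snd c)"
  using manifold unfolding smooth_manifold_def is_chart_def by blast+

lemma topspace_chart: "c \<in> \<A> \<Longrightarrow> topspace (subtopology T (fst c)) = fst c"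
  using openin_subset[OF chart_domain_openin[of c]] by auto

lemma chart_inj_on: "c \<in> \<A> \<Longrightarrow> inj_on (snd c) (fst c)"
  using homeomorphic_imp_injective_map[OF chart_homeomorphic_map] topspace_chart by metis

lemma chart_inv_chart: "c \<in> \<A> \<Longrightarrow> q \<in> fst c \<Longrightarrow> chart_inv c (snd c q) = q"
  by (simp add: chart_inv_def chart_inj_on)

lemma chart_inv_in_domain: "x \<in> chart_image c \<Longrightarrow> chart_inv c x \<in> fst c"
  by (simp add: chart_inv_def chart_image_def inv_into_into)

lemma chart_chart_inv: "x \<in> chart_image c \<Longrightarrow> snd c (chart_inv c x) = x"
  by (simp add: chart_inv_def chart_image_def f_inv_into_f)

lemma chart_open_image:
  assumes "c \<in> \<A>" "openin T W"
  shows "open (snd c ` (fst c \<inter> W))"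
proof -
  have "openin (subtopology T (fst c)) (fst c \<inter> W)"
    using assms(2) openin_subtopology_Int2 by blast
  then have "openin (top_of_set (chart_image c)) (snd c ` (fst c \<inter> W))"
    using homeomorphic_imp_open_map[OF chart_homeomorphic_map[OF assms(1)]]
    by (simp add: open_map_def)
  then show ?thesis
    using chart_image_open[OF assms(1)] openin_open_eq by blast
qed

text \<open>\<open>chart_inv\<close> is an \<open>inv_into\<close>; it inherits continuity from the
  inverse \<open>k\<close> of the homeomorphism, with which it agrees on the chart image.\<close>

lemma chart_inv_continuous_map:
  assumes "c \<in> \<A>"
  shows "continuous_map (top_of_set (chart_image c)) T (chart_inv c)"
proof -
  obtain k where k: "homeomorphic_maps (subtopology T (fst c)) (top_of_set (chart_image c)) (snd c) k"
    using chart_homeomorphic_map[OF assms] homeomorphic_map_maps by blast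
  then have "continuous_map (top_of_set (chart_image c)) (subtopology T (fst c)) k"
    and "\<And>q. q \<in> fst c \<Longrightarrow> k (snd c q) = q"
    using topspace_chart[OF assms] unfolding homeomorphic_maps_def by blast+
  then have "continuous_map (top_of_set (chart_image c)) (subtopology T (fst c)) (chart_inv c)"
    by (elim continuous_map_eq) (auto simp: chart_image_def chart_inv_chart[OF assms])
  then show ?thesis by (simp add: continuous_map_in_subtopology)
qed

lemma chart_at_mem: "p \<in> topspace T \<Longrightarrow> chart_at \<A> p \<in> \<A>"
  and mem_chart_at: "p \<in> topspace T \<Longrightarrow> p \<in> fst (chart_at \<A> p)"
proof -
  assume "p \<in> topspace T"
  then have "\<exists>c. c \<in> \<A> \<and> p \<in> fst c" using manifold unfolding smooth_manifold_def by blast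
  from someI_ex[OF this] show "chart_at \<A> p \<in> \<A>" "p \<in> fst (chart_at \<A> p)"
    by (auto simp: chart_at_def)
qed

lemma chart_mem_topspace: "c \<in> \<A> \<Longrightarrow> q \<in> fst c \<Longrightarrow> q \<in> topspace T"
  using openin_subset[OF chart_domain_openin[of c]] by auto

section \<open>Transition maps and their Jacobians\<close>

lemma transition_Ck_on:
  "c \<in> \<A> \<Longrightarrow> d \<in> \<A> \<Longrightarrow> Ck_on k (snd d \<circ> chart_inv c) (snd c ` (fst c \<inter> fst d))"
  using manifold unfolding smooth_manifold_def smooth_on_def by blast

lemma coord_change_has_derivative:
  assumes "c \<in> \<A>" "d \<in> \<A>" "q \<in> fst c" "q \<in> fst d"
  shows "(snd d \<circ> chart_inv c has_derivative coord_change c d q) (at (snd c q))"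
  unfolding coord_change_def
  using assms by (intro Ck_on_Suc_has_derivative[OF transition_Ck_on[where k = "Suc 0"]]
      chart_open_image chart_domain_openin) auto

lemma coord_change_linear:
  "c \<in> \<A> \<Longrightarrow> d \<in> \<A> \<Longrightarrow> q \<in> fst c \<Longrightarrow> q \<in> fst d \<Longrightarrow> linear (coord_change c d q)"
  using coord_change_has_derivative has_derivative_linear by blast

lemma coord_change_self:
  assumes "c \<in> \<A>" "q \<in> fst c"
  shows "coord_change c c q v = v"
proof -
  have "((\<lambda>x. x) has_derivative (\<lambda>v. v)) (at (snd c q))" by (rule has_derivative_ident)
  then have "(snd c \<circ> chart_inv c has_derivative (\<lambda>v. v)) (at (snd c q))"
    by (rule has_derivative_transform_within_open[OF _ chart_image_open[OF assms(1)]])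
      (use assms in \<open>auto simp: chart_chart_inv\<close>, auto simp: chart_image_def)
  then show ?thesis
    using has_derivative_unique coord_change_has_derivative[OF assms(1,1,2,2)] by metis
qed

text \<open>Chain rule: near \<open>snd c q\<close> the two transition maps compose to the direct
  one. This cocycle rule removes the preferred charts from coordinate expressions.\<close>

lemma coord_change_trans:
  assumes "c \<in> \<A>" "d \<in> \<A>" "e \<in> \<A>" "q \<in> fst c" "q \<in> fst d" "q \<in> fst e"
  shows "coord_change d e q (coord_change c d q v) = coord_change c e q v"
proof -
  let ?U = "snd c ` (fst c \<inter> fst d)"
  have U: "open ?U" "snd c q \<in> ?U"
    using assms chart_open_image chart_domain_openin by blast+
  have "(snd e \<circ> chart_inv d has_derivative coord_change d e q) (at ((snd d \<circ> chart_inv c) (snd c q)))"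
    using coord_change_has_derivative[of d e q] assms by (simp add: chart_inv_chart)
  from has_derivative_compose[OF coord_change_has_derivative[of c d q] this]
  have "((\<lambda>x. (snd e \<circ> chart_inv d) ((snd d \<circ> chart_inv c) x)) has_derivative
      (\<lambda>v. coord_change d e q (coord_change c d q v))) (at (snd c q))"
    using assms by blast
  then have "(snd e \<circ> chart_inv c has_derivative
      (\<lambda>v. coord_change d e q (coord_change c d q v))) (at (snd c q))"
    by (rule has_derivative_transform_within_open[OF _ U])
      (use assms in \<open>auto simp: chart_inv_chart\<close>)
  then show ?thesis
    using has_derivative_unique coord_change_has_derivative[of c e q] assms by metis
qed

lemma coord_change_Ck_on:
  assumes "c \<in> \<A>" "d \<in> \<A>"
  shows "Ck_on k (\<lambda>x. coord_change c d (chart_inv c x) v) (snd c ` (fst c \<inter> fst d))"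
proof (rule Ck_on_cong)
  show "Ck_on k (\<lambda>x. frechet_derivative (snd d \<circ> chart_inv c) (at x) v) (snd c ` (fst c \<inter> fst d))"
    using transition_Ck_on[OF assms, of "Suc k"] by simp
qed (use assms in \<open>auto simp: coord_change_def chart_inv_chart
    intro: chart_open_image chart_domain_openin\<close>)

text \<open>The field with constant components \<open>v\<close> in the chart at \<open>p\<close> is
  cut off by a bump function and divided by the value of the bump at its centre.\<close>

lemma ex_vector_field_at:
  assumes p: "p \<in> topspace T"
  obtains X where "vector_field \<A> X" "X p = v"
proof -
  define c where "c = chart_at \<A> p"
  have c: "c \<in> \<A>" "p \<in> fst c" using p chart_at_mem mem_chart_at by (auto simp: c_def)
  define x0 where "x0 = snd c p"
  have "x0 \<in> chart_image c" using c by (auto simp: x0_def chart_image_def)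
  \<comment> \<open>The ball is closed, so that its compactness passes to \<open>K\<close>
    below.\<close>
  then obtain r where r: "r > 0" "cball x0 r \<subseteq> chart_image c"
    using chart_image_open[OF c(1)] open_contains_cball by blast
  define \<phi> where "\<phi> x = flat_exp 0 (r\<^sup>2 + (-1) * ((x + - x0) \<bullet> (x + - x0)))" for x
  have \<phi>_smooth: "Ck_on k \<phi> UNIV" for k
    unfolding \<phi>_def by (rule Ck_on_bump)
  have \<phi>_0: "\<phi> x = 0 \<longleftrightarrow> dist x0 x \<ge> r" for x
    unfolding \<phi>_def by (rule bump_eq_0_iff[OF r(1)])
  \<comment> \<open>\<open>coord_change\<close> translates components in \<open>c\<close> into the
    representation at \<open>q\<close>, whose preferred chart may jump from point to point.\<close>
  define X where "X q = (if q \<in> fst c then \<phi> (snd c q) *\<^sub>R coord_change c (chart_at \<A> q) q v else 0)" for q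
  define K where "K = chart_inv c ` cball x0 r"
  have "compactin (top_of_set (chart_image c)) (cball x0 r)"
    using r(2) by (simp add: compactin_subtopology)
  then have "compactin T K"
    unfolding K_def using chart_inv_continuous_map[OF c(1)] by (rule image_compactin)
  \<comment> \<open>Hausdorffness makes the support of the bump closed in \<open>T\<close>, so that extension by zero is smooth.\<close>
  then have K: "openin T (topspace T - K)"
    using manifold compactin_imp_closedin unfolding smooth_manifold_def by blast
  have "vector_field \<A> X"
    unfolding vector_field_def smooth_on_def
  proof (intro ballI allI)
    fix d k assume d: "d \<in> \<A>"
    \<comment> \<open>On \<open>?U\<close> the field is given through the chart \<open>c\<close>; on
      \<open>?V\<close> it is zero. The two cover the image of \<open>d\<close> because
      \<open>K\<close> lies in the domain of \<open>c\<close>.\<close>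
    let ?U = "snd d ` (fst d \<inter> fst c)" and ?V = "snd d ` (fst d \<inter> (topspace T - K))"
    have U: "open ?U" by (intro chart_open_image chart_domain_openin d c)
    have V: "open ?V" by (intro chart_open_image d K)
    \<comment> \<open>Seen in \<open>d\<close>, the preferred chart at \<open>q\<close> cancels by
      the cocycle rule.\<close>
    have local_X: "local_field \<A> X d (snd d q) =
        (if q \<in> fst c then \<phi> (snd c q) *\<^sub>R coord_change c d q v else 0)" if q: "q \<in> fst d" for q
    proof -
      have "q \<in> topspace T" using chart_mem_topspace d q by blast
      then have *: "chart_at \<A> q \<in> \<A>" "q \<in> fst (chart_at \<A> q)"
        using chart_at_mem mem_chart_at by auto
      show ?thesis
        using coord_change_linear[OF *(1) d *(2) q] coord_change_trans[OF c(1) *(1) d _ *(2) q]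
        by (simp add: local_field_def Let_def chart_inv_chart[OF d q] X_def linear_scale linear_0)
    qed
    have "Ck_on k (local_field \<A> X d) ?U"
    proof (rule Ck_on_cong[OF U])
      have img: "(snd c \<circ> chart_inv d) ` ?U \<subseteq> snd c ` (fst c \<inter> fst d)"
        using d by (auto simp: chart_inv_chart)
      have "Ck_on k (\<lambda>x. coord_change c d (chart_inv c ((snd c \<circ> chart_inv d) x)) v) ?U"
        by (rule Ck_on_compose[OF U _ img transition_Ck_on[OF d c(1)] coord_change_Ck_on[OF c(1) d]])
          (intro chart_open_image chart_domain_openin d c)
      moreover have "Ck_on k (\<lambda>x. \<phi> ((snd c \<circ> chart_inv d) x)) ?U"
        by (rule Ck_on_compose[OF U open_UNIV _ transition_Ck_on[OF d c(1)] \<phi>_smooth]) simp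
      ultimately show "Ck_on k (\<lambda>x. \<phi> ((snd c \<circ> chart_inv d) x) *\<^sub>R
          coord_change c d (chart_inv c ((snd c \<circ> chart_inv d) x)) v) ?U"
        by (intro Ck_on_bilinear[OF bounded_bilinear_scaleR] U)
    qed (use c d in \<open>auto simp: local_X chart_inv_chart\<close>)
    moreover have "Ck_on k (local_field \<A> X d) ?V"
    proof (rule Ck_on_cong[OF V _ Ck_on_const[OF V]])
      fix x assume "x \<in> ?V"
      then obtain q where q: "q \<in> fst d" "q \<notin> K" "x = snd d q" by auto
      have "\<phi> (snd c q) = 0" if "q \<in> fst c"
      proof (rule ccontr)
        assume "\<phi> (snd c q) \<noteq> 0"
        then have "snd c q \<in> cball x0 r" by (simp add: \<phi>_0)
        then have "chart_inv c (snd c q) \<in> K" unfolding K_def by blast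
        then show False using q c that by (simp add: chart_inv_chart)
      qed
      then show "0 = local_field \<A> X d x" using q by (simp add: local_X)
    qed
    moreover have "chart_image d \<subseteq> ?U \<union> ?V"
    proof -
      have "K \<subseteq> fst c" using r(2) chart_inv_in_domain[of _ c] unfolding K_def by blast
      then show ?thesis using chart_mem_topspace[OF d] by (auto simp: chart_image_def)
    qed
    ultimately show "Ck_on k (local_field \<A> X d) (chart_image d)"
      using U V by (intro Ck_on_locally) (meson UnE subset_iff)
  qed
  then have *: "vector_field \<A> (\<lambda>q. s *\<^sub>R X q)" for s
    unfolding vector_field_def smooth_on_def
  proof (intro ballI allI)
    fix d k assume "\<forall>c\<in>\<A>. \<forall>k. Ck_on k (local_field \<A> X c) (chart_image c)" and d: "d \<in> \<A>"
    then have "Ck_on k (\<lambda>x. s *\<^sub>R local_field \<A> X d x) (chart_image d)"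
      by (intro Ck_on_bounded_linear[OF bounded_linear_scaleR_right] chart_image_open) auto
    then show "Ck_on k (local_field \<A> (\<lambda>q. s *\<^sub>R X q) d) (chart_image d)"
    proof (rule Ck_on_cong[OF chart_image_open[OF d], rotated])
      fix x assume "x \<in> chart_image d"
      then have q: "chart_inv d x \<in> fst d" by (rule chart_inv_in_domain)
      then have "linear (coord_change (chart_at \<A> (chart_inv d x)) d (chart_inv d x))"
        using chart_mem_topspace[OF d q] d by (intro coord_change_linear chart_at_mem mem_chart_at)
      then show "s *\<^sub>R local_field \<A> X d x = local_field \<A> (\<lambda>q. s *\<^sub>R X q) d x"
        by (simp add: local_field_def Let_def linear_scale)
    qed
  qed
  have "\<phi> x0 \<noteq> 0" using \<phi>_0 r(1) by simp
  moreover have "X p = \<phi> x0 *\<^sub>R v"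
    using c coord_change_self[OF c] by (simp add: X_def x0_def flip: c_def)
  ultimately have "(1 / \<phi> x0) *\<^sub>R X p = v" by simp
  then show ?thesis using that * by blast
qed

text \<open>In a chart the form is the local metric evaluated at the components of \<xi>. It is
  linear in them, so smoothness of the metric for fixed arguments suffices.\<close>

lemma one_form_metric_dual:
  assumes g: "semi_riemannian_metric T \<A> g" and \<xi>: "vector_field \<A> \<xi>"
  shows "one_form T \<A> (\<lambda>p x. g p x (\<xi> p))"
  unfolding one_form_def smooth_on_def
proof (intro conjI ballI allI)
  have bil: "bilinear (g p)" if "p \<in> topspace T" for p
    using g that by (auto simp: semi_riemannian_metric_def)
  show "linear (\<lambda>x. g p x (\<xi> p))" if "p \<in> topspace T" for p
    using bil[OF that] by (simp add: bilinear_def)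
  fix c u k assume c: "c \<in> \<A>"
  show "Ck_on k (\<lambda>x. local_form \<A> (\<lambda>p x. g p x (\<xi> p)) c x u) (chart_image c)"
  proof (rule Ck_on_cong[OF chart_image_open[OF c]])
    have lin: "linear (\<lambda>y. local_metric \<A> g c x u y)" if "x \<in> chart_image c" for x
    proof -
      define q where "q = chart_inv c x"
      have q: "q \<in> fst c" "q \<in> topspace T"
        using chart_inv_in_domain[OF that] chart_mem_topspace[OF c] by (auto simp: q_def)
      have "linear (coord_change c (chart_at \<A> q) q)"
        using q c by (intro coord_change_linear chart_at_mem mem_chart_at)
      moreover have "linear (g q (coord_change c (chart_at \<A> q) q u))"
        using bil[OF q(2)] by (simp add: bilinear_def)
      ultimately have "linear (\<lambda>y. g q (coord_change c (chart_at \<A> q) q u) (coord_change c (chart_at \<A> q) q y))"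
        using linear_compose by (fastforce simp: o_def)
      then show ?thesis by (simp add: local_metric_def Let_def flip: q_def)
    qed
    show "Ck_on k (\<lambda>x. local_metric \<A> g c x u (local_field \<A> \<xi> c x)) (chart_image c)"
      by (rule Ck_on_linear_in_field[OF chart_image_open[OF c] _ _ lin])
        (use c g \<xi> in \<open>auto simp: semi_riemannian_metric_def vector_field_def smooth_on_def\<close>)
    fix x assume "x \<in> chart_image c"
    then have q: "chart_inv c x \<in> fst c" "chart_inv c x \<in> topspace T"
      using chart_inv_in_domain[of x c] chart_mem_topspace[OF c] by auto
    note ca = chart_at_mem[OF q(2)] mem_chart_at[OF q(2)]
    \<comment> \<open>Passing from the preferred chart to \<open>c\<close> and back is the identity
      on the value of \<xi>.\<close>
    show "local_metric \<A> g c x u (local_field \<A> \<xi> c x) = local_form \<A> (\<lambda>p x. g p x (\<xi> p)) c x u"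
      using coord_change_trans[OF ca(1) c ca(1) ca(2) q(1) ca(2)] coord_change_self[OF ca]
      by (simp add: local_metric_def local_form_def local_field_def Let_def)
  qed
qed

lemma smooth_function_divide_const:
  assumes "smooth_function \<A> f"
  shows "smooth_function \<A> (\<lambda>p. f p / s)"
  unfolding smooth_function_def smooth_on_def
proof (intro ballI allI)
  fix c k assume "c \<in> \<A>"
  then have "Ck_on k (\<lambda>x. (f \<circ> chart_inv c) x / s) (chart_image c)"
    using assms unfolding smooth_function_def smooth_on_def
    by (intro Ck_on_bounded_linear[OF bounded_linear_divide] chart_image_open) blast+
  then show "Ck_on k ((\<lambda>p. f p / s) \<circ> chart_inv c) (chart_image c)"
    by (simp add: o_def)
qed

end


section \<open>Curvature at a point\<close>

text \<open>The identity has trace n, and the rank-one map sending x to A(x) \<xi> has trace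
  A(\<xi>).\<close>

lemma trace_projection_complement:
  fixes A :: "real^'n \<Rightarrow> real"
  assumes "linear A"
  shows "trace (matrix (\<lambda>x. K *\<^sub>R (x - A x *\<^sub>R \<xi>))) = K * (real CARD('n) - A \<xi>)"
proof -
  have "A \<xi> = A (\<Sum>i\<in>UNIV. (\<xi> $ i) *\<^sub>R axis i 1)"
    using basis_expansion[of \<xi>] by (simp add: scalar_mult_eq_scaleR)
  also have "\<dots> = (\<Sum>i\<in>UNIV. \<xi> $ i * A (axis i 1))"
    using assms by (simp add: linear_sum linear_scale)
  finally have "A \<xi> = (\<Sum>i\<in>UNIV. \<xi> $ i * A (axis i 1))" .
  then show ?thesis
    by (simp add: trace_def matrix_def sum_distrib_left[symmetric] sum_subtractf mult.commute)
qed

text \<open>The \<open>b\<close>-part of \<open>R x \<xi>\<^sub>1 \<xi>\<^sub>1\<close> cancels, so the trace defining \<open>S \<xi>\<^sub>1 \<xi>\<^sub>1\<close> sees only \<open>K\<close>.\<close>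

lemma trace_mixed_quasi_constant:
  fixes G :: "real^'n \<Rightarrow> real^'n \<Rightarrow> real" and R :: "real^'n \<Rightarrow> real^'n"
  assumes G: "bilinear G" "\<And>x y. G x y = G y x" "\<And>x. (\<And>y. G x y = 0) \<Longrightarrow> x = 0"
    and \<xi>: "G \<xi>\<^sub>1 \<xi>\<^sub>1 = 1" "G \<xi>\<^sub>1 \<xi>\<^sub>2 = 0"
    and E: "\<And>x y. E x y = G x \<xi>\<^sub>1 * G y \<xi>\<^sub>2 + G y \<xi>\<^sub>1 * G x \<xi>\<^sub>2"
    and R: "\<And>x w. G (R x) w = K * (G \<xi>\<^sub>1 \<xi>\<^sub>1 * G x w - G x \<xi>\<^sub>1 * G \<xi>\<^sub>1 w)
      + b * (G x w * E \<xi>\<^sub>1 \<xi>\<^sub>1 - G x \<xi>\<^sub>1 * E \<xi>\<^sub>1 w + G \<xi>\<^sub>1 \<xi>\<^sub>1 * E x w - G \<xi>\<^sub>1 w * E x \<xi>\<^sub>1)"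
  shows "trace (matrix R) = K * (real CARD('n) - 1)"
proof -
  have lin: "linear (\<lambda>x. G x y)" for y using G(1) by (simp add: bilinear_def)
  have "R x = K *\<^sub>R (x - G x \<xi>\<^sub>1 *\<^sub>R \<xi>\<^sub>1)" for x
  proof -
    \<comment> \<open>Nondegeneracy identifies \<open>R x\<close> once the difference is orthogonal
      to every \<open>w\<close>.\<close>
    have "G (R x - K *\<^sub>R (x - G x \<xi>\<^sub>1 *\<^sub>R \<xi>\<^sub>1)) w = 0" for w
    proof -
      have "G (R x - K *\<^sub>R (x - G x \<xi>\<^sub>1 *\<^sub>R \<xi>\<^sub>1)) w = G (R x) w - K * (G x w - G x \<xi>\<^sub>1 * G \<xi>\<^sub>1 w)"
        by (simp add: linear_diff[OF lin] linear_scale[OF lin])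
      \<comment> \<open>Here \<open>E \<xi>\<^sub>1 \<xi>\<^sub>1 = 0\<close>,
        \<open>E \<xi>\<^sub>1 w = G w \<xi>\<^sub>2\<close> and
        \<open>E x \<xi>\<^sub>1 = G x \<xi>\<^sub>2\<close>, so the other terms with factor
        \<open>b\<close> cancel.\<close>
      also have "\<dots> = 0"
        using R[of x w] \<xi> G(2)[of w \<xi>\<^sub>1] by (simp add: E algebra_simps)
      finally show ?thesis .
    qed
    then show ?thesis using G(3) by (metis eq_iff_diff_eq_0)
  qed
  then have "R = (\<lambda>x. K *\<^sub>R (x - G x \<xi>\<^sub>1 *\<^sub>R \<xi>\<^sub>1))" by blast
  then show ?thesis using trace_projection_complement[OF lin, of K \<xi>\<^sub>1 \<xi>\<^sub>1] \<xi>(1) by simp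
qed

text \<open>Since C = H + r / ((n-1)(n-2)) Q, the two terms (n-2) m H cancel, leaving l H and a
  multiple of Q.\<close>

lemma semiconformal_tensor_eq:
  fixes \<A> :: "('a, 'n::finite) chart set"
  assumes "CARD('n) > 3"
  shows "semiconformal_tensor \<A> g l m p x y z w = l p * conharmonic_tensor \<A> g p x y z w
    - m p * scalar_curvature \<A> g p / (real CARD('n) - 1) * (g p y z * g p x w - g p x z * g p y w)"
proof -
  define n where "n = real CARD('n)"
  have n: "n - 2 \<noteq> 0" "n - 1 \<noteq> 0" using assms by (auto simp: n_def)
  define r where "r = scalar_curvature \<A> g p"
  define Q where "Q = g p y z * g p x w - g p x z * g p y w"
  define H where "H = conharmonic_tensor \<A> g p x y z w"
  define t where "t = r / ((n - 1) * (n - 2))"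
  have "conformal_tensor \<A> g p x y z w = H + t * Q"
    unfolding H_def Q_def r_def t_def conformal_tensor_def conharmonic_tensor_def Let_def n_def[symmetric]
    by (simp add: algebra_simps)
  then have "semiconformal_tensor \<A> g l m p x y z w = l p * H - m p * ((n - 2) * t) * Q"
    unfolding semiconformal_tensor_def Let_def n_def[symmetric] H_def[symmetric]
    by (simp add: algebra_simps)
  moreover have "(n - 2) * t = r / (n - 1)" using n by (simp add: t_def)
  ultimately show ?thesis
    by (simp add: H_def r_def Q_def n_def)
qed

theorem theorem3p2:
  fixes T :: "'a topology" and \<A> :: "('a, 'n::finite) chart set" and g :: "('a, 'n) metric"
    and l m :: "'a \<Rightarrow> real"
  assumes "CARD('n) > 3"
    and "mixed_quasi_einstein T \<A> g"
    and "smooth_function \<A> l" and "\<forall>p\<in>topspace T. l p \<noteq> 0"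
    and "smooth_function \<A> m" and "\<forall>p\<in>topspace T. m p \<noteq> 0"
    and "semiconformally_flat T \<A> g l m"
  shows "mixed_quasi_constant_curvature T \<A> g"
proof -
  from assms(2) obtain \<alpha> \<beta> \<xi>\<^sub>1 \<xi>\<^sub>2 A B where
    M: "semi_riemannian_manifold T \<A> g" and nonflat: "\<not> flat_manifold T \<A> g" and
    smooth: "smooth_function \<A> \<alpha>" "smooth_function \<A> \<beta>" and
    \<xi>: "vector_field \<A> \<xi>\<^sub>1" "vector_field \<A> \<xi>\<^sub>2" and
    AB: "A = (\<lambda>p x. g p x (\<xi>\<^sub>1 p))" "B = (\<lambda>p x. g p x (\<xi>\<^sub>2 p))" and
    unit: "\<And>p. p \<in> topspace T \<Longrightarrow>
      g p (\<xi>\<^sub>1 p) (\<xi>\<^sub>1 p) = 1 \<and> g p (\<xi>\<^sub>2 p) (\<xi>\<^sub>2 p) = 1 \<and> g p (\<xi>\<^sub>1 p) (\<xi>\<^sub>2 p) = 0" and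
    ric: "\<And>X Y p. vector_field \<A> X \<Longrightarrow> vector_field \<A> Y \<Longrightarrow> p \<in> topspace T \<Longrightarrow>
      ricci \<A> g p (X p) (Y p) = \<alpha> p * g p (X p) (Y p) + \<beta> p * mixed_product A B p (X p) (Y p)"
    unfolding mixed_quasi_einstein_def by blast
  have man: "smooth_manifold T \<A>" and met: "semi_riemannian_metric T \<A> g"
    using M by (auto simp: semi_riemannian_manifold_def)
  define n where "n = real CARD('n)"
  have n: "n > 3" using assms(1) by (simp add: n_def)
  \<comment> \<open>Stated for arbitrary tangent vectors and with the final, smooth coefficients;
    values of vector fields are a special case.\<close>
  have curv: "riemann4 \<A> g p x y z w = \<alpha> p / (n - 1) * (g p y z * g p x w - g p x z * g p y w)
      + \<beta> p / (n - 2) * (g p x w * mixed_product A B p y z - g p x z * mixed_product A B p y w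
          + g p y z * mixed_product A B p x w - g p y w * mixed_product A B p x z)"
    if p: "p \<in> topspace T" for p x y z w
  proof -
    note extend = ex_vector_field_at[OF man p]
    let ?E = "mixed_product A B p"
    have S: "ricci \<A> g p u v = \<alpha> p * g p u v + \<beta> p * ?E u v" for u v
      using extend[of u] extend[of v] ric p by metis
    have flat: "semiconformal_tensor \<A> g l m p x y z w = 0" for x y z w
    proof -
      obtain X where X: "vector_field \<A> X" "X p = x" by (rule extend)
      obtain Y where Y: "vector_field \<A> Y" "Y p = y" by (rule extend)
      obtain Z where Z: "vector_field \<A> Z" "Z p = z" by (rule extend)
      obtain W where W: "vector_field \<A> W" "W p = w" by (rule extend)
      show ?thesis
        using assms(7)[unfolded semiconformally_flat_def, rule_format, OF X(1) Y(1) Z(1) W(1) p]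
        by (simp only: X Y Z W)
    qed
    have l: "l p \<noteq> 0" using assms(4) p by blast
    \<comment> \<open>The metric part of the Ricci tensor enters the conharmonic tensor twice,
      giving the first summand; semiconformal flatness gives the second. Smoothness is not visible
      in this form, which contains \<open>scalar_curvature\<close>.\<close>
    define K where "K = 2 * \<alpha> p / (n - 2) + m p * scalar_curvature \<A> g p / (l p * (n - 1))"
    have R: "riemann4 \<A> g p x y z w = K * (g p y z * g p x w - g p x z * g p y w)
      + \<beta> p / (n - 2) * (g p x w * ?E y z - g p x z * ?E y w + g p y z * ?E x w - g p y w * ?E x z)"
      for x y z w
    proof -
      define Q where "Q = g p y z * g p x w - g p x z * g p y w"
      define F where "F = g p x w * ?E y z - g p x z * ?E y w + g p y z * ?E x w - g p y w * ?E x z"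
      have "l p * conharmonic_tensor \<A> g p x y z w = m p * scalar_curvature \<A> g p / (n - 1) * Q"
        using flat[of x y z w] semiconformal_tensor_eq[OF assms(1), of \<A> g l m p x y z w]
        by (simp add: n_def Q_def)
      then have H: "conharmonic_tensor \<A> g p x y z w = m p * scalar_curvature \<A> g p / (l p * (n - 1)) * Q"
        using l n by (simp add: field_simps)
      have "g p x w * ricci \<A> g p y z - g p x z * ricci \<A> g p y w
          + g p y z * ricci \<A> g p x w - g p y w * ricci \<A> g p x z = 2 * \<alpha> p * Q + \<beta> p * F"
        by (simp add: S Q_def F_def algebra_simps)
      then have "conharmonic_tensor \<A> g p x y z w
          = riemann4 \<A> g p x y z w - 1 / (n - 2) * (2 * \<alpha> p * Q + \<beta> p * F)"
        by (simp add: conharmonic_tensor_def Let_def n_def)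
      then show ?thesis
        using H unfolding K_def Q_def[symmetric] F_def[symmetric]
        by (simp add: algebra_simps add_divide_distrib)
    qed
    have G: "bilinear (g p)" "\<And>x y. g p x y = g p y x" "\<And>x. (\<And>y. g p x y = 0) \<Longrightarrow> x = 0"
      using met p unfolding semi_riemannian_metric_def by blast+
    \<comment> \<open>Two evaluations of the same Ricci value, by the trace of the curvature just
      found and by the quasi-Einstein equation, determine \<open>K\<close> without computing the
      scalar curvature.\<close>
    have "ricci \<A> g p (\<xi>\<^sub>1 p) (\<xi>\<^sub>1 p) = K * (n - 1)"
      unfolding ricci_def n_def
    proof (rule trace_mixed_quasi_constant[OF G, where b = "\<beta> p / (n - 2)"])
      show "?E x y = g p x (\<xi>\<^sub>1 p) * g p y (\<xi>\<^sub>2 p) + g p y (\<xi>\<^sub>1 p) * g p x (\<xi>\<^sub>2 p)" for x y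
        by (simp add: mixed_product_def AB)
    qed (use unit[OF p] R[unfolded riemann4_def] in blast)+
    \<comment> \<open>The mixed product vanishes on this pair because \<open>\<xi>\<^sub>1 p\<close>
      and \<open>\<xi>\<^sub>2 p\<close> are orthogonal.\<close>
    moreover have "ricci \<A> g p (\<xi>\<^sub>1 p) (\<xi>\<^sub>1 p) = \<alpha> p"
      using S[of "\<xi>\<^sub>1 p" "\<xi>\<^sub>1 p"] unit[OF p] by (simp add: mixed_product_def AB)
    ultimately have "K = \<alpha> p / (n - 1)" using n by (simp add: field_simps)
    then show ?thesis using R by simp
  qed
  have "one_form T \<A> A" "one_form T \<A> B"
    unfolding AB by (intro one_form_metric_dual[OF man met] \<xi>)+
  \<comment> \<open>The forms take the value 1 on \<open>\<xi>\<^sub>1 p\<close> and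
    \<open>\<xi>\<^sub>2 p\<close> respectively.\<close>
  moreover have "\<forall>p\<in>topspace T. (\<exists>x. A p x \<noteq> 0) \<and> (\<exists>x. B p x \<noteq> 0)"
    unfolding AB using unit by (metis zero_neq_one)
  ultimately show ?thesis
    unfolding mixed_quasi_constant_curvature_def Let_def
    using M nonflat curv smooth_function_divide_const[OF man smooth(1), of "n - 1"]
      smooth_function_divide_const[OF man smooth(2), of "n - 2"]
    by (intro conjI exI[of _ "\<lambda>p. \<alpha> p / (n - 1)"] exI[of _ "\<lambda>p. \<beta> p / (n - 2)"] exI[of _ A] exI[of _ B])
      auto
qed

end
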